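(* Let $F\subset[0,1]$ be the middle third Cantor set (with the Euclidean metric), whose dimension is $s=\log_3 2$. Then for any $\delta\in[1,1+1/s]$ there exists a choice $P$ of abstract rationals in $F$ such that $d(P)=\delta$ and (with $F_t$ defined using $P$) $$\dim_{\mathrm H}F_t=\frac{\delta}{t}\,s\qquad\text{for all }t\geq \delta.$$
   Context: For a non-empty totally bounded metric space $F$ with metric $\rho$, a set $A\subseteq F$ is $r$-separated if $\rho(a,b)\geq r$ for all distinct $a,b\in A$. A choice of abstract rationals in $F$ is a family $P=(P(q))_{q\in\mathbb{N}}$, $\mathbb N=\{1,2,\dots\}$, where each $P(q)\subseteq F$ is a maximal $(1/q)$-separated set, i.e. it is $(1/q)$-separated and no further point of $F$ can be added while keeping it $(1/q)$-separated. Given such a choice and $t>0$, $$F_t=\bigcap_{N}\bigcup_{q>N}\bigcup_{p\in P(q)}B(p,1/q^t),$$ where $B(x,r)$ denotes the closed ball in $F$; that is, $F_t$ is the set of $x\in F$ such that for infinitely many $q$ there is $p\in P(q)$ with $\rho(p,x)\leq 1/q^t$. $\mathcal{H}^s$ denotes $s$-dimensional Hausdorff measure and $\dim_{\mathrm H}$ Hausdorff dimension. A compact metric space $F$ is $s$-Ahlfors--David regular if there is $C>0$ with $r^s/C\leq\mathcal{H}^s(B(x,r))\leq Cr^s$ for all $0<r<1$ and $x\in F$; the middle third Cantor set is such a space with $s=\log_3 2$. For an $s$-Ahlfors--David regular $F$ and a choice $P$ of abstract rationals in $F$, the Dirichlet exponent is $$d(P)=\sup\{\delta>0 : \text{there is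 a ball } B\subset F \text{ of positive radius with } \mathcal{H}^s(B\setminus F_\delta)=0\}.$$ *)

theory Defs
  imports "HOL-Analysis.Analysis"
begin

primrec cantor_level :: "nat \<Rightarrow> real set" where
  "cantor_level 0 = {0..1}"
| "cantor_level (Suc n) =
     (\<lambda>x. x / 3) ` cantor_level n \<union> (\<lambda>x. 2 / 3 + x / 3) ` cantor_level n"

definition cantor_set :: "real set" where
  "cantor_set = (\<Inter>n. cantor_level n)"

text \<open>
  The gauge is \<open>diam U\<close> raised to the power \<open>s\<close>, with \<open>0\<^sup>0 = 1\<close> for non-empty \<open>U\<close> (so that
  \<open>s = 0\<close> yields counting measure, whereas \<open>0 powr 0 = 0\<close>), and value \<open>0\<close> for the empty set.
\<close>

definition hausdorff_gauge :: "real \<Rightarrow> 'a::metric_space set \<Rightarrow> ennreal" where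
  "hausdorff_gauge s U =
     (if U = {} then 0 else if s = 0 then 1 else ennreal (diameter U powr s))"

text \<open>
  Boundedness of the covering sets is required explicitly because the library's
  \<^const>\<open>diameter\<close> is unspecified on unbounded sets.
\<close>

definition hausdorff_premeasure :: "real \<Rightarrow> real \<Rightarrow> 'a::metric_space set \<Rightarrow> ennreal" where
  "hausdorff_premeasure s \<epsilon> A =
     (INF U \<in> {U :: nat \<Rightarrow> 'a set. A \<subseteq> (\<Union>i. U i) \<and> (\<forall>i. bounded (U i) \<and> diameter (U i) \<le> \<epsilon>)}.
        \<Sum>i. hausdorff_gauge s (U i))"

text \<open>
  The Hausdorff (outer) measure, on arbitrary subsets. Replacing a cover of \<open>A\<close> by its traces
  on \<open>A\<close> does not increase diameters, so for \<open>A \<subseteq> F\<close> the value is the same whether it is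
  computed in the ambient space or in the subspace \<open>F\<close>.
\<close>

definition hausdorff_measure :: "real \<Rightarrow> 'a::metric_space set \<Rightarrow> ennreal" where
  "hausdorff_measure s A = (SUP \<epsilon>\<in>{0<..}. hausdorff_premeasure s \<epsilon> A)"

definition hausdorff_dim :: "'a::metric_space set \<Rightarrow> ereal" where
  "hausdorff_dim A = Inf (ereal ` {s. 0 \<le> s \<and> hausdorff_measure s A = 0})"

text \<open>
  Below, the metric space \<open>F\<close> is a subset of the ambient type with the restricted metric; its
  closed balls are the sets \<open>cball x r \<inter> F\<close> with \<open>x \<in> F\<close>.
\<close>

definition separated_in :: "'a::metric_space set \<Rightarrow> real \<Rightarrow> 'a set \<Rightarrow> bool" where
  "separated_in F r A \<longleftrightarrow> A \<subseteq> F \<and> pairwise (\<lambda>a b. r \<le> dist a b) A"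

definition maximal_separated_in :: "'a::metric_space set \<Rightarrow> real \<Rightarrow> 'a set \<Rightarrow> bool" where
  "maximal_separated_in F r A \<longleftrightarrow>
     separated_in F r A \<and> (\<forall>x \<in> F - A. \<not> separated_in F r (insert x A))"

text \<open>The index \<open>q\<close> ranges over the positive integers; the value \<open>P 0\<close> is irrelevant.\<close>

definition abstract_rationals :: "'a::metric_space set \<Rightarrow> (nat \<Rightarrow> 'a set) \<Rightarrow> bool" where
  "abstract_rationals F P \<longleftrightarrow> (\<forall>q\<ge>1. maximal_separated_in F (1 / real q) (P q))"

definition approximable ::
    "'a::metric_space set \<Rightarrow> (nat \<Rightarrow> 'a set) \<Rightarrow> real \<Rightarrow> 'a set" where
  "approximable F P t =
     (\<Inter>N::nat. \<Union>q\<in>{N<..}. \<Union>p\<in>P q. cball p (1 / real q powr t) \<inter> F)"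

definition dirichlet_exponent ::
    "'a::metric_space set \<Rightarrow> real \<Rightarrow> (nat \<Rightarrow> 'a set) \<Rightarrow> ereal" where
  "dirichlet_exponent F s P =
     Sup (ereal ` {\<delta>. 0 < \<delta> \<and>
       (\<exists>x\<in>F. \<exists>r>0. hausdorff_measure s ((cball x r \<inter> F) - approximable F P \<delta>) = 0)})"

end

theory Submission
  imports Defs
begin

text \<open>
  Points of the Cantor set are coded by binary digit sequences. For \<open>3\<^sup>n \<le> q < 3\<^sup>n\<^sup>+\<^sup>1\<close> a maximal
  \<open>1/q\<close>-separated set may be formed by extending all \<open>2\<^sup>n\<^sup>+\<^sup>1\<close> prefixes of length \<open>n + 1\<close>; for
  \<open>q \<ge> 2 \<cdot> 3\<^sup>n\<close> the extension is arbitrary, provided that it is the same for every prefix. Letting it run through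
  all words of length \<open>\<lfloor>n (\<delta> - 1)\<rfloor>\<close>, of which there are at most \<open>3\<^sup>n\<close> because \<open>\<delta> \<le> 1 + 1/s\<close>,
  the rationals with \<open>q\<close> in this range comprise all words of length about \<open>n \<delta>\<close>, and essentially nothing else.
  Covering by the balls around them bounds the dimension from above. Conversely, a point whose
  digits vanish between positions \<open>n \<delta>\<close> and \<open>n t\<close> for infinitely many \<open>n\<close> lies in \<open>F\<^sub>t\<close>. If these
  \<open>n\<close> are sparse, then reading the remaining digits in base two gives a map onto \<open>[0, 1]\<close> that is
  Hoelder continuous with any exponent below \<open>\<delta> s / t\<close>, so that the Hausdorff measure of that order is positive.
\<close>

section \<open>Digit expansions\<close>

text \<open>The partial sums telescope: \<open>step\<close> turns the first \<open>n\<close> terms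
  into \<open>x 0 - x n / b ^ n\<close>, and boundedness of \<open>x\<close> makes the remainder
  vanish.\<close>

lemma expansion_sums:
  fixes b :: real
  assumes "1 < b" and x: "\<And>i. 0 \<le> x i" "\<And>i. x i \<le> 1"
    and step: "\<And>i. x i = (a i + x (Suc i)) / b"
  shows "(\<lambda>i. a i / b ^ Suc i) sums x 0"
proof -
  have part: "(\<Sum>i<n. a i / b ^ Suc i) = x 0 - x n / b ^ n" for n
  proof (induction n)
    case (Suc n)
    have "x n / b ^ n = (a n + x (Suc n)) / b ^ Suc n"
      by (simp add: step[of n])
    then have "x n / b ^ n = a n / b ^ Suc n + x (Suc n) / b ^ Suc n"
      by (simp only: add_divide_distrib)
    with Suc.IH show ?case by (simp only: sum.lessThan_Suc)
  qed simp
  have "(\<lambda>n. (1 / b) ^ n) \<longlonglongrightarrow> 0"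
    using \<open>1 < b\<close> by (intro LIMSEQ_realpow_zero) auto
  then have "(\<lambda>n. x n / b ^ n) \<longlonglongrightarrow> 0"
  proof (rule Lim_null_comparison[rotated])
    have "norm (x n / b ^ n) \<le> (1 / b) ^ n" for n
      using x[of n] \<open>1 < b\<close> by (simp add: power_one_over divide_right_mono)
    then show "\<forall>\<^sub>F n in sequentially. norm (x n / b ^ n) \<le> (1 / b) ^ n"
      by (intro always_eventually) auto
  qed
  then have "(\<lambda>n. x 0 - x n / b ^ n) \<longlonglongrightarrow> x 0 - 0"
    by (intro tendsto_intros)
  then show ?thesis
    unfolding sums_def part by simp
qed

text \<open>With \<open>b = 3\<close> the digits are 0 and 2, which codes the Cantor set; with
  \<open>b = 2\<close> this is the ordinary binary expansion. One definition lets the same estimates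
  serve both.\<close>

definition digit_value :: "real \<Rightarrow> (nat \<Rightarrow> bool) \<Rightarrow> real" where
  "digit_value b d = (\<Sum>i. (b - 1) * of_bool (d i) / b ^ Suc i)"

lemma digit_value_eqI:
  fixes b :: real
  assumes "1 < b" "\<And>i. 0 \<le> x i" "\<And>i. x i \<le> 1"
    and "\<And>i. x i = ((b - 1) * of_bool (d i) + x (Suc i)) / b"
  shows "digit_value b d = x 0"
proof -
  have "(\<lambda>i. (b - 1) * of_bool (d i) / b ^ Suc i) sums x 0"
    by (rule expansion_sums) fact+
  then show ?thesis
    unfolding digit_value_def by (rule sums_unique[symmetric])
qed

lemma digit_value_True: "1 < b \<Longrightarrow> digit_value b (\<lambda>_. True) = 1"
  by (rule digit_value_eqI[where x = "\<lambda>_. 1"]) auto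

lemma digit_value_False: "digit_value b (\<lambda>_. False) = 0"
  by (simp add: digit_value_def)

lemma digit_value_summable:
  fixes b :: real
  assumes "1 < b"
  shows "summable (\<lambda>i. (b - 1) * of_bool (d i) / b ^ Suc i)"
proof (rule summable_comparison_test'[where N = 0])
  have "(\<lambda>i. (b - 1) / b ^ Suc i) sums 1"
    using expansion_sums[of b "\<lambda>_. 1" "\<lambda>_. b - 1"] assms by simp
  then show "summable (\<lambda>i. (b - 1) / b ^ Suc i)"
    by (rule sums_summable)
  show "norm ((b - 1) * of_bool (d i) / b ^ Suc i) \<le> (b - 1) / b ^ Suc i" for i
    using assms by (cases "d i") auto
qed

lemma digit_value_bounds:
  assumes "1 < b"
  shows "0 \<le> digit_value b d" "digit_value b d \<le> 1"
proof -
  show "0 \<le> digit_value b d"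
    unfolding digit_value_def
    by (rule suminf_nonneg[OF digit_value_summable[OF assms]]) (use assms in simp)
  have "digit_value b d \<le> digit_value b (\<lambda>_. True)"
    unfolding digit_value_def
    by (rule suminf_le[OF _ digit_value_summable[OF assms] digit_value_summable[OF assms]])
       (use assms in simp)
  then show "digit_value b d \<le> 1"
    by (simp add: digit_value_True assms)
qed

lemma digit_value_split:
  assumes "1 < b"
  shows "digit_value b d =
    (\<Sum>i<n. (b - 1) * of_bool (d i) / b ^ Suc i) + digit_value b (\<lambda>i. d (i + n)) / b ^ n"
proof -
  have "(\<Sum>i. (b - 1) * of_bool (d (i + n)) / b ^ Suc (i + n))
      = (\<Sum>i. ((b - 1) * of_bool (d (i + n)) / b ^ Suc i) / b ^ n)"
    by (intro suminf_cong) (simp add: power_add field_simps)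
  also have "\<dots> = digit_value b (\<lambda>i. d (i + n)) / b ^ n"
    unfolding digit_value_def
    by (rule suminf_divide) (rule digit_value_summable[OF assms])
  finally show ?thesis
    unfolding digit_value_def[of b d]
    by (subst suminf_split_initial_segment[OF digit_value_summable[OF assms], of _ n]) simp
qed

lemma digit_value_Suc:
  "1 < b \<Longrightarrow> digit_value b d = ((b - 1) * of_bool (d 0) + digit_value b (\<lambda>i. d (Suc i))) / b"
  using digit_value_split[of b d 1] by (simp add: field_simps)

lemma digit_value_agree:
  assumes "1 < b" "\<And>i. i < n \<Longrightarrow> d i = d' i"
  shows "\<bar>digit_value b d - digit_value b d'\<bar> \<le> 1 / b ^ n"
proof -
  let ?v = "digit_value b (\<lambda>i. d (i + n))" and ?v' = "digit_value b (\<lambda>i. d' (i + n))"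
  have "(\<Sum>i<n. (b - 1) * of_bool (d i) / b ^ Suc i) = (\<Sum>i<n. (b - 1) * of_bool (d' i) / b ^ Suc i)"
    by (intro sum.cong) (use assms(2) in auto)
  then have "digit_value b d - digit_value b d' = (?v - ?v') / b ^ n"
    using digit_value_split[OF assms(1), of d n] digit_value_split[OF assms(1), of d' n]
    by (simp add: diff_divide_distrib)
  moreover have "\<bar>?v - ?v'\<bar> \<le> 1"
    using digit_value_bounds[OF assms(1)] by (smt (verit))
  ultimately show ?thesis
    using assms(1) by (simp add: divide_right_mono)
qed

text \<open>Kept as an identity because the rationals below have opposite or equal tails, where more
  is needed than the general lower bound \<open>1 / 3 ^ Suc n\<close>.\<close>

lemma digit_value_first_difference:
  assumes "1 < b" "\<And>i. i < n \<Longrightarrow> d i = d' i" "d n" "\<not> d' n"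
  shows "digit_value b d - digit_value b d' =
    (b - 1 + digit_value b (\<lambda>i. d (i + Suc n)) - digit_value b (\<lambda>i. d' (i + Suc n))) / b ^ Suc n"
proof -
  have "(\<Sum>i<n. (b - 1) * of_bool (d i) / b ^ Suc i) = (\<Sum>i<n. (b - 1) * of_bool (d' i) / b ^ Suc i)"
    by (intro sum.cong) (use assms(2) in auto)
  then show ?thesis
    using assms(3,4) digit_value_split[OF assms(1), of d "Suc n"]
      digit_value_split[OF assms(1), of d' "Suc n"]
    by (simp add: diff_divide_distrib add_divide_distrib)
qed

text \<open>The first differing digit contributes 2 and the tails differ by at most 1, so a gap of 1
  remains at scale \<open>3 ^ Suc n\<close>.\<close>

lemma digit_value_3_separated:
  assumes "\<And>i. i < n \<Longrightarrow> d i = d' i" "d n \<noteq> d' n"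
  shows "1 / 3 ^ Suc n \<le> \<bar>digit_value 3 d - digit_value 3 d'\<bar>"
proof -
  have *: "1 / 3 ^ Suc n \<le> digit_value 3 d - digit_value 3 d'"
    if "\<And>i. i < n \<Longrightarrow> d i = d' i" "d n" "\<not> d' n" for d d'
  proof -
    have "1 \<le> 3 - 1 + digit_value 3 (\<lambda>i. d (i + Suc n)) - digit_value 3 (\<lambda>i. d' (i + Suc n))"
      using digit_value_bounds[of 3 "\<lambda>i. d (i + Suc n)"] digit_value_bounds[of 3 "\<lambda>i. d' (i + Suc n)"]
      by simp
    then show ?thesis
      using digit_value_first_difference[of 3 n d d'] that by (simp add: divide_right_mono)
  qed
  show ?thesis
    using *[of d d'] *[of d' d] assms by (cases "d n") auto
qed

lemma digit_value_2_surj: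
  assumes "0 \<le> x" "x \<le> 1"
  obtains d where "digit_value 2 d = x"
proof -
  \<comment> \<open>The doubling map, with its second branch closed at 1 so that it preserves the
    unit interval; the digits record which branch the orbit takes.\<close>
  define T where "T x = (if x < 1/2 then 2 * x else 2 * x - 1)" for x :: real
  have T: "0 \<le> (T ^^ i) x \<and> (T ^^ i) x \<le> 1" for i
    by (induction i) (use assms in \<open>auto simp: T_def\<close>)
  have "digit_value 2 (\<lambda>i. \<not> (T ^^ i) x < 1/2) = (T ^^ 0) x"
    by (rule digit_value_eqI[where x = "\<lambda>i. (T ^^ i) x"]) (use T in \<open>auto simp: T_def field_simps\<close>)
  then show ?thesis by (intro that) auto
qed

section \<open>The Cantor set as the image of the digit coding\<close>

lemma cantor_level_bounds: "x \<in> cantor_level n \<Longrightarrow> 0 \<le> x \<and> x \<le> 1"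
proof (induction n arbitrary: x)
  case (Suc n)
  then obtain z where "z \<in> cantor_level n" "x = z / 3 \<or> x = 2/3 + z / 3" by auto
  with Suc.IH[of z] show ?case by auto
qed simp

text \<open>One formula inverts both contractions, since their images lie in [0, 1/3] and [2/3, 1].
  Iterating it produces the digits of a point.\<close>

lemma cantor_set_step:
  assumes "x \<in> cantor_set"
  defines "y \<equiv> if x \<le> 1/3 then 3 * x else 3 * x - 2"
  shows "y \<in> cantor_set"
proof -
  have "y \<in> cantor_level n" for n
  proof -
    have "x \<in> cantor_level (Suc n)"
      using assms unfolding cantor_set_def by blast
    then consider z where "z \<in> cantor_level n" "x = z / 3" | z where "z \<in> cantor_level n" "x = 2/3 + z / 3"
      by auto
    then show ?thesis
    proof cases
      case 1
      with cantor_level_bounds[of z n] have "y = z" by (simp add: y_def)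
      with 1 show ?thesis by simp
    next
      case 2
      with cantor_level_bounds[of z n] have "y = z" by (simp add: y_def)
      with 2 show ?thesis by simp
    qed
  qed
  then show ?thesis by (auto simp: cantor_set_def)
qed

lemma digit_value_3_cantor_level: "digit_value 3 d \<in> cantor_level n"
proof (induction n arbitrary: d)
  case 0
  then show ?case using digit_value_bounds[of 3 d] by simp
next
  case (Suc n)
  have "digit_value 3 d = digit_value 3 (\<lambda>i. d (Suc i)) / 3
      \<or> digit_value 3 d = 2 / 3 + digit_value 3 (\<lambda>i. d (Suc i)) / 3"
    using digit_value_Suc[of 3 d] by (cases "d 0") auto
  then show ?case using Suc[of "\<lambda>i. d (Suc i)"] by auto
qed

lemma cantor_set_eq: "cantor_set = range (digit_value 3)"
proof
  show "range (digit_value 3) \<subseteq> cantor_set"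
    using digit_value_3_cantor_level by (auto simp: cantor_set_def)
  show "cantor_set \<subseteq> range (digit_value 3)"
  proof
    fix x assume x: "x \<in> cantor_set"
    define T where "T x = (if x \<le> 1/3 then 3 * x else 3 * x - 2)" for x :: real
    have T: "(T ^^ i) x \<in> cantor_set" for i
    proof (induction i)
      case (Suc i)
      then show ?case using cantor_set_step[OF Suc] by (simp add: T_def[of "(T ^^ i) x"])
    qed (use x in simp)
    then have "0 \<le> (T ^^ i) x \<and> (T ^^ i) x \<le> 1" for i
      using cantor_level_bounds[of "(T ^^ i) x" 0] unfolding cantor_set_def by blast
    moreover define d where "d i \<longleftrightarrow> \<not> (T ^^ i) x \<le> 1/3" for i
    ultimately have "digit_value 3 d = (T ^^ 0) x"
      by (intro digit_value_eqI[where x = "\<lambda>i. (T ^^ i) x"]) (auto simp: T_def field_simps)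
    then show "x \<in> range (digit_value 3)" by auto
  qed
qed

section \<open>Hausdorff measure\<close>

lemma hausdorff_premeasure_le:
  assumes "A \<subseteq> (\<Union>i. U i)" "\<And>i. bounded (U i)" "\<And>i. diameter (U i) \<le> \<epsilon>"
  shows "hausdorff_premeasure \<sigma> \<epsilon> A \<le> (\<Sum>i. hausdorff_gauge \<sigma> (U i))"
  unfolding hausdorff_premeasure_def by (rule INF_lower) (use assms in auto)

lemma hausdorff_gauge_empty [simp]: "hausdorff_gauge \<sigma> {} = 0"
  by (simp add: hausdorff_gauge_def)

lemma hausdorff_premeasure_single:
  assumes "A \<subseteq> U" "bounded U" "diameter U \<le> \<epsilon>" "0 < \<epsilon>"
  shows "hausdorff_premeasure \<sigma> \<epsilon> A \<le> hausdorff_gauge \<sigma> U"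
proof -
  let ?U = "\<lambda>i::nat. if i = 0 then U else {}"
  have "hausdorff_premeasure \<sigma> \<epsilon> A \<le> (\<Sum>i. hausdorff_gauge \<sigma> (?U i))"
  proof (rule hausdorff_premeasure_le)
    have "?U 0 \<subseteq> (\<Union>i. ?U i)" by blast
    with assms(1) show "A \<subseteq> (\<Union>i. ?U i)" by simp
  qed (use assms in auto)
  also have "\<dots> = hausdorff_gauge \<sigma> U"
    by (subst suminf_finite[of "{0}"]) auto
  finally show ?thesis .
qed

lemma hausdorff_premeasure_empty: "0 < \<epsilon> \<Longrightarrow> hausdorff_premeasure \<sigma> \<epsilon> {} = 0"
  using hausdorff_premeasure_single[of "{}" "{}" \<epsilon> \<sigma>] by simp

lemma hausdorff_premeasure_mono:
  "A \<subseteq> B \<Longrightarrow> hausdorff_premeasure \<sigma> \<epsilon> A \<le> hausdorff_premeasure \<sigma> \<epsilon> B"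
  unfolding hausdorff_premeasure_def by (rule INF_superset_mono) auto

text \<open>Subadditivity holds at each fixed scale, which suffices because null sets are detected
  by the premeasures alone. The n-th cover is chosen with loss e / 2^(n+1).\<close>

lemma hausdorff_premeasure_countable_UN:
  "hausdorff_premeasure \<sigma> \<epsilon> (\<Union>n. A n) \<le> (\<Sum>n. hausdorff_premeasure \<sigma> \<epsilon> (A n))"
proof (rule ennreal_le_epsilon)
  fix e :: real
  assume e: "0 < e" and fin: "(\<Sum>n. hausdorff_premeasure \<sigma> \<epsilon> (A n)) < top"
  have "\<exists>U::nat \<Rightarrow> 'a set. (A n \<subseteq> (\<Union>i. U i) \<and> (\<forall>i. bounded (U i) \<and> diameter (U i) \<le> \<epsilon>))
      \<and> (\<Sum>i. hausdorff_gauge \<sigma> (U i)) \<le> hausdorff_premeasure \<sigma> \<epsilon> (A n) + ennreal (e * (1/2)^Suc n)" for n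
  proof -
    have "hausdorff_premeasure \<sigma> \<epsilon> (A n) \<noteq> top"
      using ennreal_suminf_lessD[OF fin] by (simp add: less_top)
    then have "hausdorff_premeasure \<sigma> \<epsilon> (A n) < hausdorff_premeasure \<sigma> \<epsilon> (A n) + ennreal (e * (1/2)^Suc n)"
      using e by (simp add: ennreal_add_left_cancel_less flip: less_top)
    then show ?thesis
      by (subst (asm) (1) hausdorff_premeasure_def) (auto simp: INF_less_iff intro: less_imp_le)
  qed
  then obtain U where U: "\<And>n. A n \<subseteq> (\<Union>i. U n i)" "\<And>n i. bounded (U n i)" "\<And>n i. diameter (U n i) \<le> \<epsilon>"
    "\<And>n. (\<Sum>i. hausdorff_gauge \<sigma> (U n i)) \<le> hausdorff_premeasure \<sigma> \<epsilon> (A n) + ennreal (e * (1/2)^Suc n)"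
    by metis
  let ?V = "\<lambda>j. case prod_decode j of (n, i) \<Rightarrow> U n i"
  have "hausdorff_premeasure \<sigma> \<epsilon> (\<Union>n. A n) \<le> (\<Sum>j. hausdorff_gauge \<sigma> (?V j))"
  proof (rule hausdorff_premeasure_le)
    show "(\<Union>n. A n) \<subseteq> (\<Union>j. ?V j)"
    proof
      fix x assume "x \<in> (\<Union>n. A n)"
      then obtain n i where "x \<in> U n i" using U(1) by blast
      then have "x \<in> ?V (prod_encode (n, i))" by simp
      then show "x \<in> (\<Union>j. ?V j)" by (rule UN_I[OF UNIV_I])
    qed
  qed (use U in \<open>auto split: prod.split\<close>)
  also have "\<dots> = (\<Sum>j. (\<lambda>(n, i). hausdorff_gauge \<sigma> (U n i)) (prod_decode j))"
    by (intro suminf_cong) (simp split: prod.split)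
  also have "\<dots> = (\<Sum>n. \<Sum>i. hausdorff_gauge \<sigma> (U n i))"
    by (rule suminf_ennreal_2dimen) simp
  also have "\<dots> \<le> (\<Sum>n. hausdorff_premeasure \<sigma> \<epsilon> (A n) + ennreal (e * (1/2)^Suc n))"
    by (intro suminf_le U) auto
  also have "\<dots> = (\<Sum>n. hausdorff_premeasure \<sigma> \<epsilon> (A n)) + (\<Sum>n. ennreal (e * (1/2)^Suc n))"
    by (rule suminf_add[symmetric]) auto
  also have "(\<Sum>n. ennreal (e * (1/2)^Suc n)) = ennreal e"
    using sums_mult[OF power_half_series, of e] e
    by (intro suminf_ennreal_eq) auto
  finally show "hausdorff_premeasure \<sigma> \<epsilon> (\<Union>n. A n) \<le> (\<Sum>n. hausdorff_premeasure \<sigma> \<epsilon> (A n)) + ennreal e" .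
qed

lemma hausdorff_premeasure_Un:
  assumes "0 < \<epsilon>"
  shows "hausdorff_premeasure \<sigma> \<epsilon> (A \<union> B) \<le> hausdorff_premeasure \<sigma> \<epsilon> A + hausdorff_premeasure \<sigma> \<epsilon> B"
proof -
  let ?A = "\<lambda>n::nat. if n = 0 then A else if n = 1 then B else {}"
  have "?A 0 \<union> ?A 1 \<subseteq> (\<Union>n. ?A n)" by blast
  then have "hausdorff_premeasure \<sigma> \<epsilon> (A \<union> B) \<le> hausdorff_premeasure \<sigma> \<epsilon> (\<Union>n. ?A n)"
    by (intro hausdorff_premeasure_mono) simp
  also have "\<dots> \<le> (\<Sum>n. hausdorff_premeasure \<sigma> \<epsilon> (?A n))"
    by (rule hausdorff_premeasure_countable_UN)
  also have "\<dots> = hausdorff_premeasure \<sigma> \<epsilon> A + hausdorff_premeasure \<sigma> \<epsilon> B"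
    by (subst suminf_finite[of "{0, 1}"]) (auto simp: hausdorff_premeasure_empty[OF assms])
  finally show ?thesis .
qed

lemma hausdorff_premeasure_finite_UN:
  assumes "finite I" "0 < \<epsilon>" "\<And>i. i \<in> I \<Longrightarrow> hausdorff_premeasure \<sigma> \<epsilon> (A i) \<le> c"
  shows "hausdorff_premeasure \<sigma> \<epsilon> (\<Union>i\<in>I. A i) \<le> of_nat (card I) * c"
  using assms(1,3)
proof (induction I rule: finite_induct)
  case empty
  then show ?case by (simp add: hausdorff_premeasure_empty[OF assms(2)])
next
  case (insert i I)
  have "hausdorff_premeasure \<sigma> \<epsilon> (\<Union>i\<in>insert i I. A i)
      \<le> hausdorff_premeasure \<sigma> \<epsilon> (A i) + hausdorff_premeasure \<sigma> \<epsilon> (\<Union>i\<in>I. A i)"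
    using hausdorff_premeasure_Un[OF assms(2)] by simp
  also have "\<dots> \<le> c + of_nat (card I) * c"
    using insert by (intro add_mono) auto
  finally show ?case using insert by (simp add: algebra_simps)
qed

lemma hausdorff_measure_eq_0_iff:
  "hausdorff_measure \<sigma> A = 0 \<longleftrightarrow> (\<forall>\<epsilon>>0. hausdorff_premeasure \<sigma> \<epsilon> A = 0)"
  unfolding hausdorff_measure_def by (subst bot_ennreal[symmetric], subst SUP_bot_conv) (auto simp: bot_ennreal)

lemma hausdorff_measure_neq_0I:
  "0 < \<epsilon> \<Longrightarrow> hausdorff_premeasure \<sigma> \<epsilon> A \<noteq> 0 \<Longrightarrow> hausdorff_measure \<sigma> A \<noteq> 0"
  by (simp add: hausdorff_measure_eq_0_iff) blast

lemma hausdorff_measure_empty: "hausdorff_measure \<sigma> {} = 0"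
  by (simp add: hausdorff_measure_eq_0_iff hausdorff_premeasure_empty)

lemma hausdorff_measure_eq_0_mono:
  "hausdorff_measure \<sigma> B = 0 \<Longrightarrow> A \<subseteq> B \<Longrightarrow> hausdorff_measure \<sigma> A = 0"
  by (metis hausdorff_measure_eq_0_iff hausdorff_premeasure_mono le_zero_eq)

lemma hausdorff_measure_Un_0:
  "hausdorff_measure \<sigma> A = 0 \<Longrightarrow> hausdorff_measure \<sigma> B = 0 \<Longrightarrow> hausdorff_measure \<sigma> (A \<union> B) = 0"
  using hausdorff_premeasure_Un[of _ \<sigma> A B] by (auto simp: hausdorff_measure_eq_0_iff)

section \<open>Positivity of Hausdorff measures\<close>

lemma hausdorff_measure_0_pos:
  fixes A :: "'a::metric_space set"
  assumes "A \<noteq> {}"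
  shows "hausdorff_measure 0 A \<noteq> 0"
proof -
  have "1 \<le> hausdorff_premeasure 0 1 A"
    unfolding hausdorff_premeasure_def
  proof (rule INF_greatest)
    fix U :: "nat \<Rightarrow> 'a set"
    assume "U \<in> {U. A \<subseteq> (\<Union>i. U i) \<and> (\<forall>i. bounded (U i) \<and> diameter (U i) \<le> 1)}"
    with assms obtain i where "U i \<noteq> {}" by blast
    then have "1 = (\<Sum>j\<in>{i}. hausdorff_gauge 0 (U j))" by (simp add: hausdorff_gauge_def)
    also have "\<dots> \<le> (\<Sum>j. hausdorff_gauge 0 (U j))" by (rule sum_le_suminf) auto
    finally show "1 \<le> (\<Sum>j. hausdorff_gauge 0 (U j))" .
  qed
  then have "hausdorff_premeasure 0 1 A \<noteq> 0" by auto
  then show ?thesis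
    by (rule hausdorff_measure_neq_0I[OF zero_less_one])
qed

text \<open>A cover of \<open>A\<close>, pulled back along \<open>\<phi>\<close> and pushed forward
  along \<open>h\<close>, covers the unit interval by sets of length at most \<open>K\<close> times
  the gauge; Lebesgue measure then bounds the total gauge from below. The common parameter space
  avoids inverting \<open>\<phi>\<close>.\<close>

lemma hausdorff_measure_pos_Hoelder:
  fixes \<phi> :: "'b \<Rightarrow> 'a::metric_space" and h :: "'b \<Rightarrow> real"
  assumes "0 < \<sigma>" "0 \<le> K"
    and hoelder: "\<And>u v. \<bar>h u - h v\<bar> \<le> K * dist (\<phi> u) (\<phi> v) powr \<sigma>"
    and surj: "{0..1} \<subseteq> range h" and A: "range \<phi> \<subseteq> A"
  shows "hausdorff_measure \<sigma> A \<noteq> 0"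
proof -
  have le: "1 \<le> ennreal K * (\<Sum>i. hausdorff_gauge \<sigma> (U i))"
    if U: "A \<subseteq> (\<Union>i. U i)" "\<And>i. bounded (U i)" for U :: "nat \<Rightarrow> 'a set"
  proof -
    have "\<exists>a b. h ` (\<phi> -` U i) \<subseteq> {a..b} \<and> ennreal (b - a) \<le> ennreal K * hausdorff_gauge \<sigma> (U i)" for i
    proof (cases "\<phi> -` U i = {}")
      case True
      \<comment> \<open>The enclosing interval is the empty \<open>{1..0}\<close>, whose negative
        length becomes 0 in \<open>ennreal\<close>.\<close>
      then show ?thesis by (intro exI[of _ 1] exI[of _ 0]) auto
    next
      case False
      then obtain u0 where u0: "\<phi> u0 \<in> U i" by auto
      let ?D = "K * diameter (U i) powr \<sigma>" and ?H = "h ` (\<phi> -` U i)"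
      have D: "\<bar>h u - h v\<bar> \<le> ?D" if "\<phi> u \<in> U i" "\<phi> v \<in> U i" for u v
      proof -
        have "dist (\<phi> u) (\<phi> v) powr \<sigma> \<le> diameter (U i) powr \<sigma>"
          using diameter_bounded_bound[OF U(2) that] assms(1) by (intro powr_mono2) auto
        then show ?thesis
          using hoelder[of u v] mult_left_mono[OF _ assms(2)] by (meson order_trans)
      qed
      have bdd: "bdd_below ?H"
        using D[OF u0] by (intro bdd_belowI[of _ "h u0 - ?D"]) (auto simp: abs_le_iff algebra_simps)
      have "x \<le> Inf ?H + ?D" if "x \<in> ?H" for x
      proof -
        have "x - ?D \<le> Inf ?H"
          using D that False by (intro cInf_greatest) (auto simp: abs_le_iff algebra_simps)
        then show ?thesis by simp
      qed
      then have "?H \<subseteq> {Inf ?H..Inf ?H + ?D}"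
        using cInf_lower[OF _ bdd] by (meson atLeastAtMost_iff subsetI)
      moreover have "ennreal ?D = ennreal K * hausdorff_gauge \<sigma> (U i)"
        using u0 assms(1,2) by (auto simp: hausdorff_gauge_def ennreal_mult)
      ultimately show ?thesis by (intro exI[of _ "Inf ?H"] exI[of _ "Inf ?H + ?D"]) auto
    qed
    then obtain a b where ab: "\<And>i. h ` (\<phi> -` U i) \<subseteq> {a i..b i}"
      "\<And>i. ennreal (b i - a i) \<le> ennreal K * hausdorff_gauge \<sigma> (U i)" by metis
    have "{0..1} \<subseteq> (\<Union>i. {a i..b i})"
    proof
      fix x :: real assume "x \<in> {0..1}"
      with surj obtain u where "x = h u" by blast
      moreover obtain i where "\<phi> u \<in> U i" using A U(1) by blast
      ultimately show "x \<in> (\<Union>i. {a i..b i})" using ab(1)[of i] by blast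
    qed
    then have "emeasure lborel {0..1::real} \<le> emeasure lborel (\<Union>i. {a i..b i})"
      by (rule emeasure_mono) auto
    also have "\<dots> \<le> (\<Sum>i. emeasure lborel {a i..b i})"
      by (rule emeasure_subadditive_countably) auto
    also have "\<dots> \<le> (\<Sum>i. ennreal K * hausdorff_gauge \<sigma> (U i))"
      using ab(2) by (intro suminf_le) (auto simp: emeasure_lborel_Icc_eq)
    finally show ?thesis by simp
  qed
  have "hausdorff_premeasure \<sigma> 1 A \<noteq> 0"
  proof
    assume 0: "hausdorff_premeasure \<sigma> 1 A = 0"
    \<comment> \<open>With \<open>K + 1\<close> the threshold is finite also for
      \<open>K = 0\<close>, and the contradiction becomes 1 <= K / (K + 1).\<close>
    have pos: "0 < inverse (ennreal (K + 1))"
      by (simp add: ennreal_inverse_positive)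
    have "\<exists>U::nat \<Rightarrow> 'a set. (A \<subseteq> (\<Union>i. U i) \<and> (\<forall>i. bounded (U i) \<and> diameter (U i) \<le> 1))
        \<and> (\<Sum>i. hausdorff_gauge \<sigma> (U i)) < inverse (ennreal (K + 1))"
      using pos unfolding 0[symmetric] hausdorff_premeasure_def INF_less_iff by blast
    then obtain U :: "nat \<Rightarrow> 'a set" where U: "A \<subseteq> (\<Union>i. U i)" "\<And>i. bounded (U i)"
      "(\<Sum>i. hausdorff_gauge \<sigma> (U i)) < inverse (ennreal (K + 1))" by blast
    have "1 \<le> ennreal K * (\<Sum>i. hausdorff_gauge \<sigma> (U i))" using le U by blast
    also have "\<dots> \<le> ennreal K * inverse (ennreal (K + 1))" using U(3) by (intro mult_left_mono) auto
    also have "\<dots> = ennreal (K / (K + 1))" using assms(2) by (simp add: inverse_ennreal divide_inverse ennreal_mult del: ennreal_plus)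
    also have "\<dots> < ennreal 1" using assms(2) by (intro ennreal_lessI) auto
    finally show False by simp
  qed
  then show ?thesis
    by (rule hausdorff_measure_neq_0I[OF zero_less_one])
qed

text \<open>The digits of \<open>y\<close> are consumed in order without omission, so the free
  positions of a constrained point encode an arbitrary real in base two.\<close>

definition spread :: "nat set \<Rightarrow> (nat \<Rightarrow> bool) \<Rightarrow> (nat \<Rightarrow> bool) \<Rightarrow> nat \<Rightarrow> bool" where
  "spread S b y i = (if i \<in> S then y (card (S \<inter> {..<i})) else b i)"

text \<open>Translates an index of a digit of \<open>y\<close> into the position at which
  \<open>spread\<close> places it.\<close>

lemma card_inter_lessThan_surj:
  fixes S :: "nat set"
  assumes "j < card (S \<inter> {..<N})"
  obtains i where "i \<in> S" "i < N" "card (S \<inter> {..<i}) = j"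
proof -
  have "\<exists>i\<in>S. i < N \<and> card (S \<inter> {..<i}) = j"
    using assms
  proof (induction N)
    case (Suc N)
    show ?case
    proof (cases "j < card (S \<inter> {..<N})")
      case True
      with Suc.IH show ?thesis by (meson less_Suc_eq)
    next
      case False
      have "N \<in> S"
        using False Suc.prems by (cases "N \<in> S") (auto simp: lessThan_Suc)
      then have "card (S \<inter> {..<Suc N}) = Suc (card (S \<inter> {..<N}))"
        by (simp add: lessThan_Suc)
      with False Suc.prems have "card (S \<inter> {..<N}) = j" by simp
      with \<open>N \<in> S\<close> show ?thesis by blast
    qed
  qed simp
  then show ?thesis using that by blast
qed

lemma powr_log_3_2: "3 powr (- x * log 3 2) = 2 powr - x"
  by (simp add: powr_def log_def)

text \<open>If two spread sequences first differ at position \<open>M\<close>, their Cantor points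
  are at least 3^-(M+1) apart, while the parameters agree on as many digits as there are free
  positions below \<open>M\<close>. The density bound \<open>free\<close> and 2 = 3^(log_3 2) turn
  this into a Hoelder estimate.\<close>

lemma hausdorff_measure_spread_pos:
  assumes "0 < \<beta>" and free: "\<And>N. \<beta> * real N - K \<le> real (card (S \<inter> {..<N}))"
    and A: "\<And>y. digit_value 3 (spread S b y) \<in> A"
  shows "hausdorff_measure (\<beta> * log 3 2) A \<noteq> 0"
proof (rule hausdorff_measure_pos_Hoelder)
  show "0 < \<beta> * log 3 2" using assms(1) by simp
  show "0 \<le> 2 powr (K + \<beta>)" by simp
  show "{0..1} \<subseteq> range (digit_value 2)"
    using digit_value_2_surj by (metis atLeastAtMost_iff rangeI subsetI)
  show "range (\<lambda>y. digit_value 3 (spread S b y)) \<subseteq> A" using A by blast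
  fix u v
  show "\<bar>digit_value 2 u - digit_value 2 v\<bar>
    \<le> 2 powr (K + \<beta>) * dist (digit_value 3 (spread S b u)) (digit_value 3 (spread S b v)) powr (\<beta> * log 3 2)"
  proof (cases "u = v")
    case False
    then obtain j where j: "u j \<noteq> v j" by blast
    \<comment> \<open>\<open>N\<close> is so large that more than \<open>j\<close> free positions
      lie below it, so the difference in digit \<open>j\<close> does appear in the spread
      sequences.\<close>
    obtain N where "K + real j < \<beta> * real N"
      using reals_Archimedean3[OF assms(1)] by (metis mult.commute)
    then have "j < card (S \<inter> {..<N})" using free[of N] by simp
    then obtain i where "i \<in> S" "card (S \<inter> {..<i}) = j" by (rule card_inter_lessThan_surj)
    with j have ex: "spread S b u i \<noteq> spread S b v i" by (simp add: spread_def)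
    define M where "M = (LEAST i. spread S b u i \<noteq> spread S b v i)"
    have M: "spread S b u M \<noteq> spread S b v M" unfolding M_def using ex by (rule LeastI)
    have less_M: "spread S b u i = spread S b v i" if "i < M" for i
      using not_less_Least that unfolding M_def by blast
    let ?r = "card (S \<inter> {..<M})"
    have "u j = v j" if less: "j < ?r" for j
    proof -
      obtain i where "i \<in> S" "i < M" "card (S \<inter> {..<i}) = j"
        using less by (rule card_inter_lessThan_surj)
      with less_M[of i] show ?thesis by (simp add: spread_def)
    qed
    then have "\<bar>digit_value 2 u - digit_value 2 v\<bar> \<le> 1 / 2 ^ ?r"
      by (intro digit_value_agree) auto
    also have "\<dots> = 2 powr - real ?r"
      by (simp add: powr_minus powr_realpow field_simps)
    also have "\<dots> \<le> 2 powr (K - \<beta> * real M)"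
      using free[of M] by simp
    \<comment> \<open>The constant absorbs the offset \<open>K\<close> and the passage from
      \<open>M\<close> to \<open>Suc M\<close>.\<close>
    also have "\<dots> = 2 powr (K + \<beta>) * 2 powr - (\<beta> * real (Suc M))"
      by (subst powr_add[symmetric]) (simp add: algebra_simps)
    also have "2 powr - (\<beta> * real (Suc M)) = 3 powr (- (\<beta> * real (Suc M)) * log 3 2)"
      by (rule powr_log_3_2[symmetric])
    also have "\<dots> = (3 powr - real (Suc M)) powr (\<beta> * log 3 2)"
      by (subst powr_powr) (simp add: algebra_simps)
    also have "3 powr - real (Suc M) = 1 / (3::real) ^ Suc M"
      by (simp only: powr_minus powr_realpow zero_less_numeral inverse_eq_divide)
    also have "(1 / (3::real) ^ Suc M) powr (\<beta> * log 3 2)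
        \<le> \<bar>digit_value 3 (spread S b u) - digit_value 3 (spread S b v)\<bar> powr (\<beta> * log 3 2)"
      using digit_value_3_separated[of M "spread S b u" "spread S b v"] less_M M assms(1)
      by (intro powr_mono2) auto
    finally show ?thesis by (simp add: dist_real_def)
  qed simp
qed

text \<open>Fixing the first \<open>M\<close> digits of \<open>x\<close> stays inside the ball once
  3^-M < r; all later digits are free, so the density is 1 with offset \<open>M\<close>.\<close>

lemma hausdorff_measure_cantor_ball_pos:
  assumes "x \<in> cantor_set" "0 < r"
  shows "hausdorff_measure (log 3 2) (cball x r \<inter> cantor_set) \<noteq> 0"
proof -
  obtain d where d: "x = digit_value 3 d" using assms(1) by (auto simp: cantor_set_eq)
  obtain M where M: "(1 / 3 :: real) ^ M < r"
    using real_arch_pow_inv[OF assms(2), of "1 / 3"] by auto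
  have "hausdorff_measure (1 * log 3 2) (cball x r \<inter> cantor_set) \<noteq> 0"
  proof (rule hausdorff_measure_spread_pos)
    fix N
    have "{M..} \<inter> {..<N} = {M..<N}" by auto
    then show "1 * real N - real M \<le> real (card ({M..} \<inter> {..<N}))" by simp
  next
    fix y
    have "\<bar>digit_value 3 d - digit_value 3 (spread {M..} d y)\<bar> \<le> 1 / 3 ^ M"
      by (intro digit_value_agree) (auto simp: spread_def)
    with M show "digit_value 3 (spread {M..} d y) \<in> cball x r \<inter> cantor_set"
      by (simp add: d cantor_set_eq dist_real_def power_one_over)
  qed simp
  then show ?thesis by simp
qed

section \<open>Rationals with prescribed digits\<close>

definition level :: "nat \<Rightarrow> nat" where
  "level q = (GREATEST n. 3 ^ n \<le> q)"

lemma level: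
  assumes "1 \<le> q"
  shows "3 ^ level q \<le> q" "q < 3 ^ Suc (level q)"
proof -
  \<comment> \<open>Bounds the exponents, so that \<open>GREATEST\<close> has a maximum to
    select.\<close>
  have bound: "n \<le> q" if "3 ^ n \<le> q" for n :: nat
  proof -
    have "n < 3 ^ n" by (rule power_gt_expt) simp
    from less_le_trans[OF this that] show ?thesis by (rule less_imp_le)
  qed
  show "3 ^ level q \<le> q"
    unfolding level_def
    by (rule GreatestI_nat[of "\<lambda>n. 3 ^ n \<le> q" 0 q]) (use assms in simp, rule bound)
  show "q < 3 ^ Suc (level q)"
  proof (rule ccontr)
    assume "\<not> q < 3 ^ Suc (level q)"
    then have "Suc (level q) \<le> level q"
      unfolding level_def[of q] not_less by (rule Greatest_le_nat) (rule bound)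
    then show False by simp
  qed
qed

lemma level_eq: "3 ^ n \<le> q \<Longrightarrow> q < 3 ^ Suc n \<Longrightarrow> level q = n"
proof -
  assume *: "3 ^ n \<le> q" "q < 3 ^ Suc n"
  then have "1 \<le> q" by (meson le_trans one_le_numeral one_le_power)
  from level[OF this] * have "3 ^ n < (3::nat) ^ Suc (level q)" "3 ^ level q < (3::nat) ^ Suc n"
    by linarith+
  then have "n < Suc (level q)" "level q < Suc n"
    by (auto simp only: power_strict_increasing_iff intro: power_less_imp_less_exp[of "3::nat"])
  then show ?thesis by simp
qed

text \<open>For \<open>q\<close> in the upper range of level n, the binary digits of the offset q -
  2 * 3^n supply the next \<open>k n\<close> digits, followed by zeros. The offset takes all values
  below 3^n, so every word of length \<open>k n\<close> occurs when 2^(k n) <= 3^n. In the lower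
  range the tail repeats the digit \<open>b\<close> at position n.\<close>

definition rational_tail :: "(nat \<Rightarrow> nat) \<Rightarrow> nat \<Rightarrow> bool \<Rightarrow> nat \<Rightarrow> bool" where
  "rational_tail k q b i =
     (if q < 2 * 3 ^ level q then b
      else i < Suc (level q) + k (level q) \<and> bit (q - 2 * 3 ^ level q) (i - Suc (level q)))"

text \<open>
  For \<open>q < 2 \<cdot> 3\<^sup>n\<close>, where \<open>n = level q\<close>, these are the endpoints of the intervals of level \<open>n\<close>.
\<close>

definition cantor_rationals :: "(nat \<Rightarrow> nat) \<Rightarrow> nat \<Rightarrow> real set" where
  "cantor_rationals k q =
     digit_value 3 ` {d. \<forall>i>level q. d i = rational_tail k q (d (level q)) i}"

text \<open>Let n = \<open>level q\<close>. A first difference before position n is settled by digit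
  separation. At position n the tails decide: opposite constant tails leave distance 3^-n, enough
  for all q >= 3^n; equal tails leave only 2 / 3^(n+1), enough for q >= 2 * 3^n. Hence the two
  ranges of \<open>q\<close>.\<close>

lemma cantor_rationals_separated:
  assumes "1 \<le> q" and d: "\<forall>i>level q. d i = rational_tail k q (d (level q)) i"
    and d': "\<forall>i>level q. d' i = rational_tail k q (d' (level q)) i" and "d \<noteq> d'"
  shows "1 / real q \<le> \<bar>digit_value 3 d - digit_value 3 d'\<bar>"
proof -
  let ?n = "level q"
  have q: "(3::real) ^ ?n \<le> real q"
    using level(1)[OF assms(1)] by (metis of_nat_le_iff of_nat_numeral of_nat_power)
  from \<open>d \<noteq> d'\<close> obtain i where i: "d i \<noteq> d' i" by blast
  define N where "N = (LEAST i. d i \<noteq> d' i)"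
  have N: "d N \<noteq> d' N" unfolding N_def using i by (rule LeastI)
  have less_N: "d i = d' i" if "i < N" for i
    using not_less_Least that unfolding N_def by blast
  \<comment> \<open>Past position \<open>level q\<close> the digits are a function of the digit
    there, so no first difference can occur.\<close>
  have "N \<le> ?n"
  proof (rule ccontr)
    assume "\<not> N \<le> ?n"
    then have "?n < N" by simp
    with d d' have "d N = rational_tail k q (d ?n) N" "d' N = rational_tail k q (d' ?n) N"
      by blast+
    with less_N[OF \<open>?n < N\<close>] N show False by simp
  qed
  show ?thesis
  proof (cases "N = ?n")
    case False
    with \<open>N \<le> ?n\<close> have "(3::real) ^ Suc N \<le> 3 ^ ?n" by (intro power_increasing) auto
    with q have "3 ^ Suc N \<le> real q" by linarith
    from frac_le[OF zero_le_one order_refl _ this] have "1 / real q \<le> 1 / 3 ^ Suc N" by simp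
    also have "\<dots> \<le> \<bar>digit_value 3 d - digit_value 3 d'\<bar>"
      by (rule digit_value_3_separated) (use less_N N in auto)
    finally show ?thesis .
  next
    case True
    have *: "1 / real q \<le> digit_value 3 d - digit_value 3 d'"
      if d: "\<forall>i>?n. d i = rational_tail k q (d ?n) i" and d': "\<forall>i>?n. d' i = rational_tail k q (d' ?n) i"
        and "\<And>i. i < ?n \<Longrightarrow> d i = d' i" "d ?n" "\<not> d' ?n" for d d'
    proof -
      have eq: "digit_value 3 d - digit_value 3 d' =
          (2 + digit_value 3 (\<lambda>i. d (i + Suc ?n)) - digit_value 3 (\<lambda>i. d' (i + Suc ?n))) / 3 ^ Suc ?n"
        using digit_value_first_difference[of 3 ?n d d'] that by simp
      show ?thesis
      proof (cases "q < 2 * 3 ^ ?n")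
        case True
        then have "(\<lambda>i. d (i + Suc ?n)) = (\<lambda>_. True)" "(\<lambda>i. d' (i + Suc ?n)) = (\<lambda>_. False)"
          using that by (auto simp: rational_tail_def)
        with eq have "digit_value 3 d - digit_value 3 d' = 1 / 3 ^ ?n"
          by (simp add: digit_value_True digit_value_False)
        with frac_le[OF zero_le_one order_refl _ q] show ?thesis by simp
      next
        case False
        then have "(\<lambda>i. d (i + Suc ?n)) = (\<lambda>i. d' (i + Suc ?n))"
          using d d' by (auto simp: rational_tail_def)
        with eq have "digit_value 3 d - digit_value 3 d' = 2 / (3 * 3 ^ ?n)" by simp
        moreover have "1 / real q \<le> 1 / (2 * 3 ^ ?n)"
        proof (rule frac_le)
          from False have "real (2 * 3 ^ ?n) \<le> real q" by (simp only: not_less of_nat_le_iff)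
          then show "2 * 3 ^ ?n \<le> real q" by simp
        qed simp_all
        moreover have "1 / (2 * 3 ^ ?n) \<le> 2 / (3 * (3::real) ^ ?n)"
          by (simp add: field_simps)
        ultimately show ?thesis by linarith
      qed
    qed
    show ?thesis
    proof (cases "d ?n")
      case d_n: True
      then show ?thesis using *[OF d d'] less_N N True by fastforce
    next
      case False
      then have "1 / real q \<le> digit_value 3 d' - digit_value 3 d"
        using less_N N True by (intro *[OF d' d]) auto
      then show ?thesis by linarith
    qed
  qed
qed

lemma abstract_rationals_cantor: "abstract_rationals cantor_set (cantor_rationals k)"
  unfolding abstract_rationals_def
proof (intro allI impI)
  fix q :: nat assume q: "1 \<le> q"
  let ?n = "level q"
  have "separated_in cantor_set (1 / real q) (cantor_rationals k q)"
    unfolding separated_in_def pairwise_def cantor_rationals_def cantor_set_eq dist_real_def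
    using cantor_rationals_separated[OF q, of _ k] by (auto; metis)
  moreover have "\<not> separated_in cantor_set (1 / real q) (insert x (cantor_rationals k q))"
    if x: "x \<in> cantor_set - cantor_rationals k q" for x
  proof
    assume sep: "separated_in cantor_set (1 / real q) (insert x (cantor_rationals k q))"
    obtain d where d: "x = digit_value 3 d" using x by (auto simp: cantor_set_eq)
    \<comment> \<open>Replacing the later digits of \<open>x\<close> by a rational tail moves it by
      at most 3^-(n+1), which is less than 1/q, against separation.\<close>
    define d' where "d' i = (if i \<le> ?n then d i else rational_tail k q (d ?n) i)" for i
    have p: "digit_value 3 d' \<in> cantor_rationals k q"
      unfolding cantor_rationals_def by (intro imageI) (auto simp: d'_def)
    with x have "x \<noteq> digit_value 3 d'" by auto
    with sep p have "1 / real q \<le> dist x (digit_value 3 d')"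
      by (auto simp: separated_in_def pairwise_def)
    also have "\<dots> \<le> 1 / 3 ^ Suc ?n"
      unfolding d dist_real_def by (rule digit_value_agree) (auto simp: d'_def)
    also have "\<dots> < 1 / real q"
    proof (rule divide_strict_left_mono)
      show "real q < 3 ^ Suc ?n"
        using level(2)[OF q] by (metis of_nat_less_iff of_nat_numeral of_nat_power)
    qed (use q in auto)
    finally show False by simp
  qed
  ultimately show "maximal_separated_in cantor_set (1 / real q) (cantor_rationals k q)"
    by (simp add: maximal_separated_in_def)
qed

text \<open>The word of \<open>d\<close> on the \<open>k n\<close> positions after n, read as a
  binary number, selects \<open>q\<close>. The resulting rational agrees with \<open>d\<close> on
  that word, and then on the zeros up to \<open>l\<close>, so its distance is at most 3^-l <=
  3^(-(n+1)t) <= q^-t.\<close>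

lemma digit_value_3_approximable:
  assumes k: "\<And>n. 2 ^ k n \<le> (3::nat) ^ n" and "0 < t"
    and gaps: "\<And>N. \<exists>n\<ge>N. \<exists>l. real (Suc n) * t \<le> real l \<and> (\<forall>i. Suc n + k n \<le> i \<and> i < l \<longrightarrow> \<not> d i)"
  shows "digit_value 3 d \<in> approximable cantor_set (cantor_rationals k) t"
  unfolding approximable_def
proof (intro INT_I)
  fix N :: nat
  obtain n l where "N \<le> n" and l: "real (Suc n) * t \<le> real l"
    and zero: "\<And>i. Suc n + k n \<le> i \<Longrightarrow> i < l \<Longrightarrow> \<not> d i"
    using gaps[of N] by blast
  define bs where "bs = map (\<lambda>i. d (Suc n + i)) [0..<k n]"
  define a :: nat where "a = horner_sum of_bool 2 bs"
  have "a < 2 ^ length bs"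
    unfolding a_def by (rule horner_sum_of_bool_2_less)
  \<comment> \<open>This keeps \<open>q\<close> below 3^(n+1), so its level is n and the offset
    decoded by \<open>rational_tail\<close> is \<open>a\<close>.\<close>
  then have a: "a < 3 ^ n" using k[of n] by (simp add: bs_def)
  define q where "q = 2 * 3 ^ n + a"
  have q: "level q = n" "\<not> q < 2 * 3 ^ n" "q - 2 * 3 ^ n = a" "q < 3 ^ Suc n"
    using a by (auto intro!: level_eq simp: q_def)
  have "n < 3 ^ n" by (rule power_gt_expt) simp
  with \<open>N \<le> n\<close> have "N < q" by (simp add: q_def)
  define d' where "d' i = (if i \<le> n then d i else rational_tail k q (d n) i)" for i
  have "d i = d' i" if "i < l" for i
  proof (cases "n < i \<and> i < Suc n + k n")
    case True
    then have "bit a (i - Suc n) = d i"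
      by (auto simp: a_def bit_horner_sum_bit_iff bs_def)
    with True q show ?thesis by (simp add: d'_def rational_tail_def)
  next
    case False
    with zero[of i] that q show ?thesis by (auto simp: d'_def rational_tail_def)
  qed
  then have "dist (digit_value 3 d') (digit_value 3 d) \<le> 1 / 3 ^ l"
    unfolding dist_commute[of "digit_value 3 d'"] dist_real_def by (intro digit_value_agree) auto
  also have "\<dots> \<le> 1 / real q powr t"
  proof (rule divide_left_mono)
    have "real q \<le> 3 ^ Suc n"
      using q(4) by (metis less_imp_le of_nat_le_iff of_nat_numeral of_nat_power)
    then have "real q powr t \<le> (3 ^ Suc n) powr t"
      using \<open>0 < t\<close> by (intro powr_mono2) auto
    also have "\<dots> = 3 powr (real (Suc n) * t)"
      by (simp only: powr_powr powr_realpow[symmetric] zero_less_numeral)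
    also have "\<dots> \<le> 3 powr real l" using l by simp
    finally show "real q powr t \<le> 3 ^ l" by (simp add: powr_realpow)
  qed (use \<open>N < q\<close> in auto)
  finally have "digit_value 3 d \<in> cball (digit_value 3 d') (1 / real q powr t) \<inter> cantor_set"
    by (simp add: cantor_set_eq)
  moreover have "digit_value 3 d' \<in> cantor_rationals k q"
    unfolding cantor_rationals_def by (intro imageI) (auto simp: d'_def q)
  ultimately show "digit_value 3 d \<in> (\<Union>q\<in>{N<..}. \<Union>p\<in>cantor_rationals k q. cball p (1 / real q powr t) \<inter> cantor_set)"
    using \<open>N < q\<close> by blast
qed

text \<open>\<open>G n\<close> depends on the level only: every rational of level n has constant
  digits from position \<open>Suc n + k n\<close> on. Covering by levels avoids counting a point
  once for each \<open>q\<close>; the radius is enlarged to its value at q = 3^n.\<close>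

lemma approximable_subset:
  fixes N :: nat and k :: "nat \<Rightarrow> nat"
  assumes "0 < t"
  defines "G \<equiv> \<lambda>n. digit_value 3 ` {d. \<forall>i\<ge>Suc n + k n. d i = d (Suc n + k n)}"
  shows "approximable cantor_set (cantor_rationals k) t
    \<subseteq> (\<Union>n. \<Union>p\<in>G (n + N). cball p (3 powr - (real (n + N) * t)))"
proof
  fix x assume "x \<in> approximable cantor_set (cantor_rationals k) t"
  \<comment> \<open>Asking for q > 3^N forces the level to be at least \<open>N\<close>.\<close>
  then obtain q p where q: "3 ^ N < q" and p: "p \<in> cantor_rationals k q" and x: "x \<in> cball p (1 / real q powr t)"
    unfolding approximable_def by blast
  let ?n = "level q"
  from q have "1 \<le> q" by simp
  note lev = level[OF this]
  have "(3::nat) ^ N < 3 ^ Suc ?n" using q lev(2) by linarith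
  then have "N < Suc ?n" by (rule power_less_imp_less_exp[rotated]) simp
  then have N: "N \<le> ?n" by simp
  have "p \<in> G ?n"
    using p unfolding cantor_rationals_def G_def by (fastforce simp: rational_tail_def)
  moreover have "1 / real q powr t \<le> 3 powr - (real ?n * t)"
  proof -
    have "(3::real) ^ ?n \<le> real q"
      using lev(1) by (metis of_nat_le_iff of_nat_numeral of_nat_power)
    then have "(3 ^ ?n) powr t \<le> real q powr t" using assms(1) by (intro powr_mono2) auto
    moreover have "(3 ^ ?n) powr t = 3 powr (real ?n * t)"
      by (simp only: powr_powr powr_realpow[symmetric] zero_less_numeral)
    ultimately have "1 / real q powr t \<le> 1 / 3 powr (real ?n * t)"
      using \<open>1 \<le> q\<close> by (intro divide_left_mono) auto
    then show ?thesis by (simp only: powr_minus_divide)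
  qed
  ultimately have "x \<in> (\<Union>p\<in>G ?n. cball p (3 powr - (real ?n * t)))" using x by fastforce
  then have "x \<in> (\<Union>p\<in>G (?n - N + N). cball p (3 powr - (real (?n - N + N) * t)))" using N by simp
  then show "x \<in> (\<Union>n. \<Union>p\<in>G (n + N). cball p (3 powr - (real (n + N) * t)))" by (rule UN_I[OF UNIV_I])
qed

section \<open>Counting rationals and the upper bound\<close>

lemma card_eventually_constant:
  "finite {d :: nat \<Rightarrow> bool. \<forall>i\<ge>M. d i = d M}" "card {d :: nat \<Rightarrow> bool. \<forall>i\<ge>M. d i = d M} \<le> 2 ^ Suc M"
proof -
  have sub: "{d. \<forall>i\<ge>M. d i = d M} \<subseteq> (\<lambda>A i. min i M \<in> A) ` Pow {..M}"
  proof
    fix d :: "nat \<Rightarrow> bool" assume d: "d \<in> {d. \<forall>i\<ge>M. d i = d M}"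
    have "d = (\<lambda>i. min i M \<in> {j\<in>{..M}. d j})"
    proof
      fix i
      have "d i = d (min i M)"
      proof (cases "i \<le> M")
        case False
        then have "M \<le> i" by simp
        with d have "d i = d M" by blast
        with \<open>M \<le> i\<close> show ?thesis by (simp add: min_absorb2)
      qed (simp add: min_absorb1)
      then show "d i = (min i M \<in> {j\<in>{..M}. d j})" by simp
    qed
    then show "d \<in> (\<lambda>A i. min i M \<in> A) ` Pow {..M}" by (rule image_eqI) auto
  qed
  then show "finite {d :: nat \<Rightarrow> bool. \<forall>i\<ge>M. d i = d M}" by (rule finite_subset) auto
  have "card {d :: nat \<Rightarrow> bool. \<forall>i\<ge>M. d i = d M} \<le> card (Pow {..M})"
    using sub by (rule surj_card_le[rotated]) auto
  then show "card {d :: nat \<Rightarrow> bool. \<forall>i\<ge>M. d i = d M} \<le> 2 ^ Suc M" by (simp add: card_Pow)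
qed

text \<open>Level n needs at most 4 * 2^(n + k n) <= 4 * 3^(n \<delta> log_3 2) balls of radius
  3^(-nt). Their gauges sum to at most \<open>C * \<rho> ^ n\<close>, and \<open>less\<close> says
  exactly that \<open>\<rho> < 1\<close>.\<close>

lemma hausdorff_measure_approximable_0:
  assumes k: "\<And>n. real (k n) \<le> real n * (\<delta> - 1)"
    and "0 < \<sigma>" "0 < t" and less: "\<delta> * log 3 2 < \<sigma> * t"
  shows "hausdorff_measure \<sigma> (approximable cantor_set (cantor_rationals k) t) = 0"
  unfolding hausdorff_measure_eq_0_iff
proof (intro allI impI)
  fix \<epsilon> :: real assume "0 < \<epsilon>"
  let ?F = "approximable cantor_set (cantor_rationals k) t"
  define G where "G n = digit_value 3 ` {d. \<forall>i\<ge>Suc n + k n. d i = d (Suc n + k n)}" for n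
  define \<rho> where "\<rho> = 3 powr (\<delta> * log 3 2 - \<sigma> * t)"
  have \<rho>: "0 < \<rho>" "\<rho> < 1" using less by (auto simp: \<rho>_def powr_less_one)
  \<comment> \<open>The 4 comes from the two extra digits in the count, the other factor from
    diameter being at most twice the radius.\<close>
  define C where "C = 4 * 2 powr \<sigma>"
  have "(\<lambda>n. 2 * (3 powr - t) ^ n) \<longlonglongrightarrow> 2 * 0"
    using \<open>0 < t\<close> by (intro tendsto_intros LIMSEQ_realpow_zero) (auto simp: powr_less_one)
  then have "\<forall>\<^sub>F n in sequentially. 2 * (3 powr - t) ^ n < \<epsilon>"
    using \<open>0 < \<epsilon>\<close> by (intro order_tendstoD) auto
  then obtain N0 where N0: "\<And>n. N0 \<le> n \<Longrightarrow> 2 * (3 powr - t) ^ n < \<epsilon>"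
    by (auto simp: eventually_sequentially)
  have pow: "(3 powr - t) ^ n = 3 powr - (real n * t)" for n
    by (simp add: powr_realpow[symmetric] powr_powr algebra_simps)
  have piece: "hausdorff_premeasure \<sigma> \<epsilon> (\<Union>p\<in>G n. cball p (3 powr - (real n * t))) \<le> ennreal (C * \<rho> ^ n)"
    if "N0 \<le> n" for n
  proof -
    let ?r = "3 powr - (real n * t)"
    have fin: "finite (G n)" unfolding G_def by (intro finite_imageI card_eventually_constant)
    have "hausdorff_premeasure \<sigma> \<epsilon> (\<Union>p\<in>G n. cball p ?r) \<le> of_nat (card (G n)) * ennreal ((2 * ?r) powr \<sigma>)"
    proof (rule hausdorff_premeasure_finite_UN[OF fin \<open>0 < \<epsilon>\<close>])
      fix p assume "p \<in> G n"
      have "hausdorff_premeasure \<sigma> \<epsilon> (cball p ?r) \<le> hausdorff_gauge \<sigma> (cball p ?r)"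
        using N0[OF that] \<open>0 < \<epsilon>\<close> by (intro hausdorff_premeasure_single) (auto simp: pow)
      also have "\<dots> \<le> ennreal ((2 * ?r) powr \<sigma>)"
        using \<open>0 < \<sigma>\<close> by (simp add: hausdorff_gauge_def)
      finally show "hausdorff_premeasure \<sigma> \<epsilon> (cball p ?r) \<le> ennreal ((2 * ?r) powr \<sigma>)" .
    qed
    also have "\<dots> = ennreal (real (card (G n)) * (2 * ?r) powr \<sigma>)"
      by (simp add: ennreal_mult ennreal_of_nat_eq_real_of_nat)
    also have "\<dots> \<le> ennreal (C * \<rho> ^ n)"
    proof (rule ennreal_leI)
      have "card (G n) \<le> 2 ^ Suc (Suc n + k n)"
        unfolding G_def using card_image_le card_eventually_constant by (meson le_trans)
      then have "real (card (G n)) \<le> 2 ^ Suc (Suc n + k n)"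
        by (metis of_nat_le_iff of_nat_numeral of_nat_power)
      also have "\<dots> = 4 * 2 powr real (n + k n)"
        by (simp add: powr_realpow del: of_nat_add)
      also have "\<dots> \<le> 4 * 2 powr (real n * \<delta>)"
        using k[of n] by (simp add: algebra_simps)
      also have "2 powr (real n * \<delta>) = 3 powr (real n * \<delta> * log 3 2)"
        using powr_log_3_2[of "- (real n * \<delta>)"] by simp
      finally have "real (card (G n)) * (2 * ?r) powr \<sigma>
          \<le> (4 * 3 powr (real n * \<delta> * log 3 2)) * (2 powr \<sigma> * 3 powr (- (real n * t) * \<sigma>))"
        by (simp add: powr_mult powr_powr mult_right_mono)
      also have "\<dots> = C * (3 powr (real n * \<delta> * log 3 2) * 3 powr (- (real n * t) * \<sigma>))"
        by (simp add: C_def)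
      also have "3 powr (real n * \<delta> * log 3 2) * 3 powr (- (real n * t) * \<sigma>)
          = 3 powr ((\<delta> * log 3 2 - \<sigma> * t) * real n)"
        by (subst powr_add[symmetric]) (simp add: algebra_simps)
      also have "\<dots> = \<rho> ^ n"
        by (simp add: \<rho>_def powr_powr[symmetric] powr_realpow)
      finally show "real (card (G n)) * (2 * ?r) powr \<sigma> \<le> C * \<rho> ^ n" .
    qed
    finally show ?thesis .
  qed
  have bound: "hausdorff_premeasure \<sigma> \<epsilon> ?F \<le> ennreal (C / (1 - \<rho>) * \<rho> ^ N)" if "N0 \<le> N" for N
  proof -
    let ?A = "\<lambda>n. \<Union>p\<in>G n. cball p (3 powr - (real n * t))"
    have "?F \<subseteq> (\<Union>n. ?A (n + N))"
      unfolding G_def by (rule approximable_subset[OF \<open>0 < t\<close>])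
    then have "hausdorff_premeasure \<sigma> \<epsilon> ?F \<le> hausdorff_premeasure \<sigma> \<epsilon> (\<Union>n. ?A (n + N))"
      by (rule hausdorff_premeasure_mono)
    also have "\<dots> \<le> (\<Sum>n. hausdorff_premeasure \<sigma> \<epsilon> (?A (n + N)))"
      by (rule hausdorff_premeasure_countable_UN)
    also have "\<dots> \<le> (\<Sum>n. ennreal (C * \<rho> ^ (n + N)))"
      using that by (intro suminf_le piece) auto
    also have "\<dots> = ennreal (C / (1 - \<rho>) * \<rho> ^ N)"
    proof (rule suminf_ennreal_eq)
      have "(\<lambda>n. (C * \<rho> ^ N) * \<rho> ^ n) sums (C * \<rho> ^ N * (1 / (1 - \<rho>)))"
        using \<rho> by (intro sums_mult geometric_sums) auto
      then show "(\<lambda>n. C * \<rho> ^ (n + N)) sums (C / (1 - \<rho>) * \<rho> ^ N)"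
        by (simp add: power_add mult_ac)
    qed (use \<rho> in \<open>auto simp: C_def\<close>)
    finally show ?thesis .
  qed
  \<comment> \<open>The scale stays fixed while the starting level grows, so the tail of the
    geometric series vanishes.\<close>
  have "(\<lambda>N. ennreal (C / (1 - \<rho>) * \<rho> ^ N)) \<longlonglongrightarrow> ennreal (C / (1 - \<rho>) * 0)"
    using \<rho> by (intro tendsto_ennrealI tendsto_intros LIMSEQ_realpow_zero) auto
  then have "hausdorff_premeasure \<sigma> \<epsilon> ?F \<le> ennreal (C / (1 - \<rho>) * 0)"
    by (rule LIMSEQ_le_const) (use bound in blast)
  then show "hausdorff_premeasure \<sigma> \<epsilon> ?F = 0" by simp
qed

section \<open>Sparse constraints on digits\<close>

lemma sparse_sequence:
  fixes g :: "nat \<Rightarrow> nat"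
  obtains f :: "nat \<Rightarrow> nat" where "strict_mono f" "\<And>j. g 0 \<le> f j" "\<And>j. g (f j) \<le> f (Suc j)"
proof -
  define h where "h x = Suc (x + g x)" for x
  \<comment> \<open>Starting the orbit at \<open>h 0\<close> rather than 0 makes even
    \<open>f 0\<close> at least \<open>g 0\<close>.\<close>
  define f where "f j = (h ^^ Suc j) 0" for j
  have f_Suc: "f (Suc j) = Suc (f j + g (f j))" for j
    by (simp add: f_def h_def)
  have "strict_mono f"
    by (simp add: strict_mono_Suc_iff f_Suc)
  moreover from this have "f 0 \<le> f j" for j
    by (simp add: strict_mono_less_eq)
  then have "g 0 \<le> f j" for j
    by (rule order_trans[rotated]) (simp add: f_def h_def)
  ultimately show ?thesis
    using that f_Suc by (metis le_SucI le_add2)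
qed

text \<open>Only the last block starting below \<open>N\<close> matters: all earlier ones end by the
  previous \<open>l\<close>, which \<open>sparse\<close> absorbs. The worst case is N = l j, where
  at least m j - l (j - 1) >= \<beta> * l j positions are free.\<close>

lemma card_sparse_complement:
  fixes m l :: "nat \<Rightarrow> nat" and \<beta> :: real
  assumes "0 \<le> \<beta>" "\<beta> \<le> 1" and m: "\<And>j. j \<le> m j" "\<And>j. m j \<le> l j" and "mono l"
    and first: "\<And>j. \<beta> * real (l j) \<le> real (m j)"
    and sparse: "\<And>j. real (l j) + \<beta> * real (l (Suc j)) \<le> real (m (Suc j))"
  shows "\<beta> * real N \<le> real (card (- (\<Union>j. {m j..<l j}) \<inter> {..<N}))"
proof -
  let ?Z = "\<Union>j. {m j..<l j}"
  have card_eq: "real (card (- ?Z \<inter> {..<N})) = real N - real (card (?Z \<inter> {..<N}))"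
  proof -
    have "card ((?Z \<inter> {..<N}) \<union> (- ?Z \<inter> {..<N})) = card (?Z \<inter> {..<N}) + card (- ?Z \<inter> {..<N})"
      by (rule card_Un_disjoint) auto
    moreover have "(?Z \<inter> {..<N}) \<union> (- ?Z \<inter> {..<N}) = {..<N}" by blast
    ultimately have "N = card (?Z \<inter> {..<N}) + card (- ?Z \<inter> {..<N})" by (metis card_lessThan)
    then show ?thesis by simp
  qed
  define J where "J = {j. m j < N}"
  have J: "finite J"
    by (rule finite_subset[of _ "{..<N}"]) (use m(1) le_less_trans in \<open>auto simp: J_def\<close>)
  show ?thesis
  proof (cases "J = {}")
    case True
    then have "\<not> (m j \<le> x \<and> x < N)" for j x
      using le_less_trans[of "m j" x N] by (auto simp: J_def)
    then have "?Z \<inter> {..<N} = {}" by auto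
    with card_eq have "real (card (- ?Z \<inter> {..<N})) = real N" by simp
    with assms(1,2) show ?thesis by (simp add: mult_left_le_one_le)
  next
    case False
    define j where "j = Max J"
    have "j \<in> J" using Max_in[OF J False] by (simp add: j_def)
    \<comment> \<open>\<open>L\<close> bounds all earlier blocks at once; the value 0 for the first
      block merges \<open>first\<close> and \<open>sparse\<close> into one inequality.\<close>
    define L where "L = (case j of 0 \<Rightarrow> 0 | Suc i \<Rightarrow> l i)"
    have L: "real L + \<beta> * real (l j) \<le> real (m j)"
      using first sparse by (cases j) (auto simp: L_def)
    have "?Z \<inter> {..<N} \<subseteq> {..<L} \<union> {m j..<min N (l j)}"
    proof
      fix x assume "x \<in> ?Z \<inter> {..<N}"
      then obtain i where i: "m i \<le> x" "x < l i" "x < N" by auto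
      then have "i \<le> j" using J by (auto simp: j_def J_def intro: Max_ge)
      show "x \<in> {..<L} \<union> {m j..<min N (l j)}"
      proof (cases "i = j")
        case True
        with i show ?thesis by simp
      next
        case False
        with \<open>i \<le> j\<close> obtain i' where "j = Suc i'" "i \<le> i'" by (cases j) auto
        with i monoD[OF \<open>mono l\<close>, of i i'] show ?thesis by (simp add: L_def)
      qed
    qed
    then have "card (?Z \<inter> {..<N}) \<le> card ({..<L} \<union> {m j..<min N (l j)})"
      by (intro card_mono) auto
    also have "\<dots> \<le> L + (min N (l j) - m j)"
      using card_Un_le[of "{..<L}" "{m j..<min N (l j)}"] by simp
    finally have Z: "card (?Z \<inter> {..<N}) \<le> L + (min N (l j) - m j)" .
    have "m j \<le> min N (l j)" using \<open>j \<in> J\<close> m(2)[of j] by (simp add: J_def)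
    with Z have "real (card (?Z \<inter> {..<N})) \<le> real L + (real (min N (l j)) - real (m j))"
      by linarith
    with L card_eq have *: "real N - real (min N (l j)) + \<beta> * real (l j) \<le> real (card (- ?Z \<inter> {..<N}))"
      by linarith
    show ?thesis
    proof (cases "N \<le> l j")
      case True
      then have "\<beta> * real N \<le> \<beta> * real (l j)" using assms(1) by (intro mult_left_mono) auto
      with * True show ?thesis by simp
    next
      case False
      \<comment> \<open>Past the last block every position below \<open>N\<close> is free, and the
        required density is at most 1.\<close>
      then have "\<beta> * (real N - real (l j)) \<le> real N - real (l j)"
        using assms(1,2) by (intro mult_left_le_one_le) auto
      with * False show ?thesis by (simp add: algebra_simps)
    qed
  qed
qed

text \<open>Zeros are imposed on blocks from about n \<delta> to about n t for sparse n, and all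
  other digits are free. At the end of a block the free density is close to \<delta> / t, so any
  smaller \<open>\<beta>\<close> is a valid lower bound.\<close>

lemma hausdorff_measure_approximable_pos:
  assumes pow_k: "\<And>n. 2 ^ k n \<le> (3::nat) ^ n"
    and k: "\<And>n. real n * (\<delta> - 1) - 1 \<le> real (k n)" "\<And>n. real (k n) \<le> real n * (\<delta> - 1)"
    and "1 \<le> \<delta>" "\<delta> \<le> t" "0 < \<beta>" "\<beta> < \<delta> / t"
  shows "hausdorff_measure (\<beta> * log 3 2) (approximable cantor_set (cantor_rationals k) t) \<noteq> 0"
proof -
  have "\<beta> * t < \<delta>" using assms by (simp add: field_simps)
  have "\<beta> < 1" using assms by (simp add: field_simps) (smt (verit) mult_le_cancel_right1)
  define m where "m n = Suc n + k n" for n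
  define l where "l n = nat \<lceil>real (Suc n) * t\<rceil>" for n
  have l: "real (Suc n) * t \<le> real (l n)" "real (l n) \<le> real (Suc n) * t + 1" for n
  proof -
    have "0 \<le> real (Suc n) * t" using assms by simp
    then show "real (Suc n) * t \<le> real (l n)" "real (l n) \<le> real (Suc n) * t + 1"
      unfolding l_def by linarith+
  qed
  have "mono l"
    unfolding l_def using assms by (intro monoI nat_mono ceiling_mono mult_right_mono) auto
  have m: "real n * \<delta> \<le> real (m n)" for n
    using k(1)[of n] by (simp add: m_def algebra_simps)
  have m_le_l: "m n \<le> l n" for n
  proof -
    have "real n * \<delta> \<le> real n * t" using assms by (intro mult_left_mono) auto
    then have "real (m n) \<le> real (Suc n) * t"
      using k(2)[of n] assms(4,5) by (simp add: m_def algebra_simps)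
    with l(1)[of n] show ?thesis by linarith
  qed
  \<comment> \<open>The threshold comes from solving l x + \<beta> ((n + 1) t + 1) <= n \<delta> for
    n, which is possible because \<beta> t < \<delta>.\<close>
  define g where "g x = nat \<lceil>(real (l x) + \<beta> * (t + 1)) / (\<delta> - \<beta> * t)\<rceil>" for x
  have g: "real (l x) + \<beta> * real (l n) \<le> real (m n)" if "g x \<le> n" for x n
  proof -
    have "(real (l x) + \<beta> * (t + 1)) / (\<delta> - \<beta> * t) \<le> real n"
      using that unfolding g_def by linarith
    then have "real (l x) + \<beta> * (t + 1) \<le> real n * (\<delta> - \<beta> * t)"
      using \<open>\<beta> * t < \<delta>\<close> by (simp add: pos_divide_le_eq)
    moreover have "\<beta> * real (l n) \<le> \<beta> * (real (Suc n) * t + 1)"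
      using l(2) \<open>0 < \<beta>\<close> by (intro mult_left_mono) auto
    ultimately show ?thesis using m[of n] by (simp add: algebra_simps)
  qed
  obtain f where f: "strict_mono f" "\<And>j. g 0 \<le> f j" "\<And>j. g (f j) \<le> f (Suc j)"
    using sparse_sequence[of g] by blast
  have f_ge: "j \<le> f j" for j using f(1) by (rule strict_mono_imp_increasing)
  define Z where "Z = (\<Union>j. {m (f j)..<l (f j)})"
  show ?thesis
  proof (rule hausdorff_measure_spread_pos[where S = "- Z" and b = "\<lambda>_. False" and K = 0])
    fix N
    have "\<beta> * real N \<le> real (card (- (\<Union>j. {m (f j)..<l (f j)}) \<inter> {..<N}))"
    proof (rule card_sparse_complement[where m = "\<lambda>j. m (f j)" and l = "\<lambda>j. l (f j)"])
      show "j \<le> m (f j)" for j using f_ge[of j] by (simp add: m_def)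
      show "mono (\<lambda>j. l (f j))"
        using \<open>mono l\<close> strict_mono_mono[OF f(1)] by (auto simp: mono_def)
      show "\<beta> * real (l (f j)) \<le> real (m (f j))" for j
        using g[OF f(2)[of j]] by simp
      show "real (l (f j)) + \<beta> * real (l (f (Suc j))) \<le> real (m (f (Suc j)))" for j
        by (rule g[OF f(3)])
    qed (use \<open>0 < \<beta>\<close> \<open>\<beta> < 1\<close> m_le_l in auto)
    then show "\<beta> * real N - 0 \<le> real (card (- Z \<inter> {..<N}))" by (simp add: Z_def)
  next
    fix y
    show "digit_value 3 (spread (- Z) (\<lambda>_. False) y) \<in> approximable cantor_set (cantor_rationals k) t"
    proof (rule digit_value_3_approximable[OF pow_k])
      fix N
      have "\<not> spread (- Z) (\<lambda>_. False) y i" if "Suc (f N) + k (f N) \<le> i" "i < l (f N)" for i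
      proof -
        have "i \<in> {m (f N)..<l (f N)}" using that by (simp add: m_def)
        then have "i \<in> Z" unfolding Z_def by (rule UN_I[OF UNIV_I])
        then show ?thesis by (simp add: spread_def)
      qed
      with f_ge[of N] l(1)[of "f N"]
      show "\<exists>n\<ge>N. \<exists>l. real (Suc n) * t \<le> real l \<and>
          (\<forall>i. Suc n + k n \<le> i \<and> i < l \<longrightarrow> \<not> spread (- Z) (\<lambda>_. False) y i)"
        by blast
    qed (use assms in simp)
  qed fact
qed

text \<open>For t < \<delta> the digits prescribed by the rationals of level n already reach beyond
  (n + 1) t once n is large, so every point qualifies.\<close>

lemma cantor_set_subset_approximable:
  assumes "\<And>n. 2 ^ k n \<le> (3::nat) ^ n" and k: "\<And>n. real n * (\<delta> - 1) - 1 \<le> real (k n)"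
    and "0 < t" "t < \<delta>"
  shows "cantor_set \<subseteq> approximable cantor_set (cantor_rationals k) t"
proof
  fix x assume "x \<in> cantor_set"
  then obtain d where d: "x = digit_value 3 d" by (auto simp: cantor_set_eq)
  show "x \<in> approximable cantor_set (cantor_rationals k) t"
    unfolding d
  proof (rule digit_value_3_approximable[OF assms(1,3)])
    fix N
    obtain n0 :: nat where n0: "t < real n0 * (\<delta> - t)"
      using reals_Archimedean3[of "\<delta> - t"] assms(4) by auto
    let ?n = "max N n0"
    have "real n0 * (\<delta> - t) \<le> real ?n * (\<delta> - t)"
      using assms(4) by (intro mult_right_mono) auto
    with n0 have "t \<le> real ?n * (\<delta> - t)" by linarith
    then have "real (Suc ?n) * t \<le> real ?n * \<delta>" by (simp add: algebra_simps)
    also have "\<dots> \<le> real (Suc ?n + k ?n)" using k[of ?n] by (simp add: algebra_simps)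
    finally have "real (Suc ?n) * t \<le> real (Suc ?n + k ?n)" .
    then show "\<exists>n\<ge>N. \<exists>l. real (Suc n) * t \<le> real l \<and> (\<forall>i. Suc n + k n \<le> i \<and> i < l \<longrightarrow> \<not> d i)"
      \<comment> \<open>With \<open>l = Suc n + k n\<close> the condition on zeros is
        vacuous.\<close>
      by (intro exI[of _ ?n] conjI max.cobounded1 exI[of _ "Suc ?n + k ?n"]) auto
  qed
qed

section \<open>Dirichlet exponent and dimension\<close>

theorem proposition3p3:
  fixes s \<delta> :: real
  assumes "s = log 3 2"
    and "\<delta> \<in> {1 .. 1 + 1 / s}"
  shows "\<exists>P. abstract_rationals cantor_set P
           \<and> dirichlet_exponent cantor_set s P = ereal \<delta>
           \<and> (\<forall>t\<ge>\<delta>. hausdorff_dim (approximable cantor_set P t) = ereal (\<delta> / t * s))"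
proof (intro exI conjI allI impI)
  have "0 < s" using assms(1) by simp
  have "1 \<le> \<delta>" using assms(2) by simp
  \<comment> \<open>The floor gives n \<delta> <= n + 1 + k n <= n \<delta> + 1, so the prescribed
    words have length n \<delta> up to a bounded error.\<close>
  define k where "k n = nat \<lfloor>real n * (\<delta> - 1)\<rfloor>" for n
  have k: "real n * (\<delta> - 1) - 1 \<le> real (k n)" "real (k n) \<le> real n * (\<delta> - 1)" for n
  proof -
    have "0 \<le> real n * (\<delta> - 1)" using \<open>1 \<le> \<delta>\<close> by simp
    then show "real n * (\<delta> - 1) - 1 \<le> real (k n)" "real (k n) \<le> real n * (\<delta> - 1)"
      unfolding k_def by linarith+
  qed
  \<comment> \<open>Here the bound \<delta> <= 1 + 1/s enters: level n has room for all words of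
    length \<open>k n\<close>.\<close>
  have pow_k: "2 ^ k n \<le> (3::nat) ^ n" for n
  proof -
    have "real n * (\<delta> - 1) \<le> real n * (1 / s)" using assms(2) by (intro mult_left_mono) auto
    with k(2)[of n] have "real (k n) \<le> real n / s" by simp
    then have "real (k n) * s \<le> real n"
      using \<open>0 < s\<close> by (simp add: pos_le_divide_eq)
    then have "3 powr (real (k n) * log 3 2) \<le> 3 powr real n" by (simp add: assms(1))
    moreover have "3 powr (real (k n) * log 3 2) = 2 powr real (k n)"
      using powr_log_3_2[of "- real (k n)"] by simp
    ultimately have "(2::real) ^ k n \<le> 3 ^ n" by (simp add: powr_realpow)
    then have "real (2 ^ k n) \<le> real (3 ^ n)" by simp
    then show ?thesis by (simp only: of_nat_le_iff)
  qed
  let ?P = "cantor_rationals k"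
  let ?F = "approximable cantor_set ?P"
  show "abstract_rationals cantor_set ?P" by (rule abstract_rationals_cantor)
  have null: "hausdorff_measure \<sigma> (?F t) = 0" if "\<delta> * s < \<sigma> * t" "0 < \<sigma>" "0 < t" for \<sigma> t
    using that unfolding assms(1) by (intro hausdorff_measure_approximable_0[OF k(2)])
  have positive: "hausdorff_measure (\<beta> * s) (?F t) \<noteq> 0" if "\<delta> \<le> t" "0 < \<beta>" "\<beta> < \<delta> / t" for \<beta> t
    unfolding assms(1) using \<open>1 \<le> \<delta>\<close> that by (intro hausdorff_measure_approximable_pos[OF pow_k k])
  show "dirichlet_exponent cantor_set s ?P = ereal \<delta>"
    unfolding dirichlet_exponent_def
  proof (rule antisym)
    let ?D = "{\<delta>. 0 < \<delta> \<and> (\<exists>x\<in>cantor_set. \<exists>r>0.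
      hausdorff_measure s (cball x r \<inter> cantor_set - ?F \<delta>) = 0)}"
    show "Sup (ereal ` ?D) \<le> ereal \<delta>"
    proof (rule Sup_least)
      fix z assume "z \<in> ereal ` ?D"
      then obtain t x r where t: "z = ereal t" "0 < t" and x: "x \<in> cantor_set" "0 < r"
        and diff: "hausdorff_measure s (cball x r \<inter> cantor_set - ?F t) = 0" by blast
      have "t \<le> \<delta>"
      proof (rule ccontr)
        assume "\<not> t \<le> \<delta>"
        \<comment> \<open>Beyond \<delta> the whole approximable set is null, so a ball that it
          fills up to a null set would be null too.\<close>
        then have "hausdorff_measure s (?F t) = 0"
          using \<open>0 < s\<close> \<open>0 < t\<close> by (intro null) (auto simp: mult.commute)
        from hausdorff_measure_Un_0[OF diff this]
        have "hausdorff_measure s (cball x r \<inter> cantor_set) = 0"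
          by (rule hausdorff_measure_eq_0_mono) auto
        with hausdorff_measure_cantor_ball_pos[OF x] show False by (simp add: assms(1))
      qed
      with t show "z \<le> ereal \<delta>" by simp
    qed
    show "ereal \<delta> \<le> Sup (ereal ` ?D)"
    proof (rule dense_le_bounded[of 0])
      show "0 < ereal \<delta>" using \<open>1 \<le> \<delta>\<close> by simp
      fix w :: ereal assume w: "0 < w" "w < ereal \<delta>"
      then obtain t where t: "w = ereal t" by (cases w) auto
      with w have "cantor_set \<subseteq> ?F t"
        by (intro cantor_set_subset_approximable[OF pow_k k(1)]) auto
      then have "cball (digit_value 3 (\<lambda>_. False)) 1 \<inter> cantor_set - ?F t = {}" by blast
      then have "hausdorff_measure s (cball (digit_value 3 (\<lambda>_. False)) 1 \<inter> cantor_set - ?F t) = 0"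
        by (simp only: hausdorff_measure_empty)
      moreover have "digit_value 3 (\<lambda>_. False) \<in> cantor_set" by (simp add: cantor_set_eq)
      moreover have "0 < t" using w t by simp
      ultimately have "t \<in> ?D"
        using zero_less_one[where 'a = real] by blast
      then show "w \<le> Sup (ereal ` ?D)" unfolding t by (intro Sup_upper imageI)
    qed
  qed
  fix t assume "\<delta> \<le> t"
  then have "0 < t" using \<open>1 \<le> \<delta>\<close> by simp
  show "hausdorff_dim (?F t) = ereal (\<delta> / t * s)"
    unfolding hausdorff_dim_def
  proof (rule antisym)
    let ?D = "{\<sigma>. 0 \<le> \<sigma> \<and> hausdorff_measure \<sigma> (?F t) = 0}"
    show "Inf (ereal ` ?D) \<le> ereal (\<delta> / t * s)"
    proof (rule dense_ge)
      fix w assume w: "ereal (\<delta> / t * s) < w"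
      show "Inf (ereal ` ?D) \<le> w"
      proof (cases w)
        case (real \<sigma>)
        with w have "\<delta> / t * s < \<sigma>" by simp
        moreover have "0 < \<delta> / t * s" using \<open>0 < s\<close> \<open>0 < t\<close> \<open>1 \<le> \<delta>\<close> by simp
        ultimately have "0 < \<sigma>" by linarith
        have "\<delta> * s < \<sigma> * t"
          using \<open>\<delta> / t * s < \<sigma>\<close> \<open>0 < t\<close> by (simp add: field_simps)
        with \<open>0 < \<sigma>\<close> have "\<sigma> \<in> ?D" using null \<open>0 < t\<close> by simp
        then show ?thesis unfolding real by (intro Inf_lower imageI)
      qed (use w in auto)
    qed
    show "ereal (\<delta> / t * s) \<le> Inf (ereal ` ?D)"
    proof (rule Inf_greatest)
      fix z assume "z \<in> ereal ` ?D"
      then obtain \<sigma> where \<sigma>: "z = ereal \<sigma>" "0 \<le> \<sigma>" "hausdorff_measure \<sigma> (?F t) = 0" by blast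
      have "\<delta> / t * s \<le> \<sigma>"
      proof (rule ccontr)
        assume "\<not> \<delta> / t * s \<le> \<sigma>"
        then have less: "\<sigma> / s < \<delta> / t" using \<open>0 < s\<close> by (simp add: pos_divide_less_eq)
        show False
        \<comment> \<open>Exponent 0 is outside the reach of the Hoelder estimate; there
          nonemptiness suffices, and it follows from positivity at some other exponent.\<close>
        proof (cases "\<sigma> = 0")
          case True
          have "0 < \<delta> / t" using \<open>1 \<le> \<delta>\<close> \<open>0 < t\<close> by simp
          then obtain \<beta> where "0 < \<beta>" "\<beta> < \<delta> / t" using dense by blast
          from positive[OF \<open>\<delta> \<le> t\<close> this] have "?F t \<noteq> {}"
            using hausdorff_measure_empty by metis
          with \<sigma> True hausdorff_measure_0_pos show False by blast
        next
          case False
          with \<sigma>(2) \<open>0 < s\<close> have "0 < \<sigma> / s" by simp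
          from positive[OF \<open>\<delta> \<le> t\<close> this less] \<sigma>(3) \<open>0 < s\<close> show False by simp
        qed
      qed
      with \<sigma> show "ereal (\<delta> / t * s) \<le> z" by simp
    qed
  qed
qed

end
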